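(* Let $X,Y$ be compact metric spaces, let $T:X\to X$ and $S:Y\to Y$ be Borel maps, and let $\pi:X\to Y$ be a continuous onto map with $\pi\circ T=S\circ\pi$. Assume that $T$ is an extension of $S$ with exponentially shrinking fibers; that $S$ admits a conformal measure $\lambda_Y\in\mathcal P(Y)$ such that the associated transfer operator has a spectral gap on some Banach space $\mathcal B$ of functions $Y\to\mathbb R$, whose normalized eigenfunction is denoted by $h$; that $T$ is Lipschitz and that $\pi$ induces a Hölder-continuous fibration; and let $\mu$ be the unique $T$-invariant probability measure such that $\pi_*\mu=h\,d\lambda_Y$. Then for all $\nu\in\mathcal P(X)$ such that $\pi_*\nu$ is absolutely continuous with respect to $\lambda_Y$ with density in $\mathcal B$, the sequence $(T^n_*\nu)_n$ converges to $\mu$ exponentially fast in the Wasserstein metric $\mathrm W$, i.e. there are $C>0$ and $\eta\in(0,1)$ such that $\mathrm W(T^n_*\nu,\mu)\le C\eta^n$ for all $n\in\mathbb N$.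
   Context: $\mathcal{P}(X)$ is the set of Borel probability measures on $X$; $f_*$ denotes push-forward. A modulus of continuity is a continuous, increasing, concave function $\omega:[0,\infty)\to[0,\infty)$ with $\omega(0)=0$. $T$ is an extension of $S$ with exponentially shrinking fibers if it is uniformly continuous along fibers (there is a modulus $\bar\omega_T$ with $d(Tx,Tx')\le\bar\omega_T(d(x,x'))$ whenever $\pi(x)=\pi(x')$) and there are $C>0$, $\theta\in(0,1)$ such that $d(T^nx,T^nx')\le C\theta^n$ for all $n$ and all $x,x'$ with $\pi(x)=\pi(x')$. Under this hypothesis every $S$-invariant probability measure has a unique $T$-invariant lift under $\pi_*$. $\pi$ induces a continuous fibration with modulus $\bar\omega_\pi$ if for all $y,y'\in Y$ and all $x\in\pi^{-1}(y)$ there is $x'\in\pi^{-1}(y')$ with $d(x,x')\le\bar\omega_\pi(d(y,y'))$; it is Hölder-continuous if one can take $\bar\omega_\pi(r)=Kr^\alpha$ for some $K>0$, $\alpha\in(0,1]$. $\lambda_Y\in\mathcal P(Y)$ is a conformal measure of $S$ when $S_*\lambda_Y$ is absolutely continuous with respect to $\lambda_Y$. The associated transfer operator $\check{\mathscr L}:L^1(\lambda_Y)\to L^1(\lambda_Y)$ is defined by $S_*(f\,d\lambda_Y)=\check{\mathscr L}(f)\,d\lambda_Y$. Given a Banach space $\mathcal B$ of functions $Y\to\mathbb R$ whose norm $\|\cdot\|$ is not less than $\|\cdot\|_\infty$, $\check{\mathscr L}$ has a spectral gap on $\mathcal B$ when: $\check{\mathscr L}$ preserves $\mathcal B$ and acts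 on it as a bounded operator; there is a positive function $h\in\mathcal B$ with $\check{\mathscr L}h=h$, normalized by $\lambda_Y(h)=\int h\,d\lambda_Y=1$; there are $C\ge1$, $\delta\in(0,1)$ such that for all $f\in\mathcal B$ with $\lambda_Y(f)=0$, $\|\check{\mathscr L}^nf\|\le C(1-\delta)^n\|f\|$ for all $n$. Then $h\,d\lambda_Y$ is an $S$-invariant probability measure. The Wasserstein metric is $\mathrm W(\mu_0,\mu_1)=\inf_\gamma\int d(x_0,x_1)\,d\gamma(x_0,x_1)$, the infimum being over couplings $\gamma\in\mathcal P(X\times X)$ with marginals $\mu_0,\mu_1$. *)

theory Defs
  imports "HOL-Probability.Probability"
begin

abbreviation borel_prob_measures :: "'a::topological_space measure set"
  where "borel_prob_measures \<equiv> space (prob_algebra borel)"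

definition modulus_of_continuity :: "(real \<Rightarrow> real) \<Rightarrow> bool" where
  "modulus_of_continuity \<omega> \<longleftrightarrow>
     \<omega> \<in> {0..} \<rightarrow> {0..} \<and> continuous_on {0..} \<omega> \<and> mono_on {0..} \<omega> \<and>
     concave_on {0..} \<omega> \<and> \<omega> 0 = 0"


subsection \<open>Extensions\<close>

text \<open>The system on the base space enters only through the semiconjugacy
  \<open>p \<circ> T = S \<circ> p\<close>, so the two conditions below mention \<open>T\<close> and \<open>p\<close> alone.\<close>

definition uniformly_continuous_along_fibers ::
  "('x::metric_space \<Rightarrow> 'x) \<Rightarrow> ('x \<Rightarrow> 'y) \<Rightarrow> bool" where
  "uniformly_continuous_along_fibers T p \<longleftrightarrow>
     (\<exists>\<omega>. modulus_of_continuity \<omega> \<and>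
        (\<forall>x x'. p x = p x' \<longrightarrow> dist (T x) (T x') \<le> \<omega> (dist x x')))"

definition exponentially_shrinking_fibers ::
  "('x::metric_space \<Rightarrow> 'x) \<Rightarrow> ('x \<Rightarrow> 'y) \<Rightarrow> bool" where
  "exponentially_shrinking_fibers T p \<longleftrightarrow>
     uniformly_continuous_along_fibers T p \<and>
     (\<exists>C>0. \<exists>\<theta>. 0 < \<theta> \<and> \<theta> < 1 \<and>
        (\<forall>n x x'. p x = p x' \<longrightarrow> dist ((T ^^ n) x) ((T ^^ n) x') \<le> C * \<theta> ^ n))"

definition continuous_fibration ::
  "('x::metric_space \<Rightarrow> 'y::metric_space) \<Rightarrow> (real \<Rightarrow> real) \<Rightarrow> bool" where
  "continuous_fibration p \<omega> \<longleftrightarrow>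
     modulus_of_continuity \<omega> \<and>
     (\<forall>y y'. \<forall>x \<in> p -` {y}. \<exists>x' \<in> p -` {y'}. dist x x' \<le> \<omega> (dist y y'))"

definition holder_continuous_fibration ::
  "('x::metric_space \<Rightarrow> 'y::metric_space) \<Rightarrow> bool" where
  "holder_continuous_fibration p \<longleftrightarrow>
     (\<exists>K>0. \<exists>\<alpha>. 0 < \<alpha> \<and> \<alpha> \<le> 1 \<and> continuous_fibration p (\<lambda>r. K * r powr \<alpha>))"


subsection \<open>Transfer operators and spectral gap\<close>

definition conformal_measure ::
  "('y::topological_space \<Rightarrow> 'y) \<Rightarrow> 'y measure \<Rightarrow> bool" where
  "conformal_measure S l \<longleftrightarrow>
     l \<in> borel_prob_measures \<and> absolutely_continuous l (distr l borel S)"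

text \<open>\<open>transfer_version S l f g\<close> states that \<open>g\<close> represents the image of \<open>f\<close> under the
  transfer operator on \<open>L\<^sup>1(l)\<close>, i.e. the equality of signed measures
  \<open>S\<^sub>*(f dl) = g dl\<close>, evaluated on every Borel set.\<close>

definition transfer_version ::
  "('y::topological_space \<Rightarrow> 'y) \<Rightarrow> 'y measure \<Rightarrow> ('y \<Rightarrow> real) \<Rightarrow> ('y \<Rightarrow> real) \<Rightarrow> bool" where
  "transfer_version S l f g \<longleftrightarrow>
     integrable l f \<and> integrable l g \<and>
     (\<forall>A \<in> sets borel. (LINT y:S -` A|l. f y) = (LINT y:A|l. g y))"

text \<open>A Banach space of functions is given by its set \<open>B\<close> of elements and its norm \<open>N\<close>,
  whose values outside \<open>B\<close> are irrelevant. The last clause says that \<open>N\<close> is not less than the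
  supremum norm.\<close>

definition banach_function_space ::
  "('y \<Rightarrow> real) set \<Rightarrow> (('y \<Rightarrow> real) \<Rightarrow> real) \<Rightarrow> bool" where
  "banach_function_space B N \<longleftrightarrow>
     (\<lambda>_. 0) \<in> B \<and>
     (\<forall>f\<in>B. \<forall>g\<in>B. (\<lambda>y. f y + g y) \<in> B) \<and>
     (\<forall>c. \<forall>f\<in>B. (\<lambda>y. c * f y) \<in> B) \<and>
     (\<forall>f\<in>B. 0 \<le> N f \<and> (N f = 0 \<longleftrightarrow> f = (\<lambda>_. 0))) \<and>
     (\<forall>f\<in>B. \<forall>g\<in>B. N (\<lambda>y. f y + g y) \<le> N f + N g) \<and>
     (\<forall>c. \<forall>f\<in>B. N (\<lambda>y. c * f y) = \<bar>c\<bar> * N f) \<and>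
     (\<forall>u. (\<forall>n::nat. u n \<in> B) \<and>
          (\<forall>e>0. \<exists>M. \<forall>m\<ge>M. \<forall>n\<ge>M. N (\<lambda>y. u m y - u n y) < e) \<longrightarrow>
          (\<exists>f\<in>B. (\<lambda>n. N (\<lambda>y. u n y - f y)) \<longlonglongrightarrow> 0)) \<and>
     (\<forall>f\<in>B. \<forall>y. \<bar>f y\<bar> \<le> N f)"

text \<open>The transfer operator acts on classes modulo \<open>l\<close>-null sets, whereas the elements of
  \<open>B\<close> are functions. That it preserves \<open>B\<close> and acts on it as a bounded operator means that
  it is represented by a bounded linear operator \<open>L\<close> of \<open>B\<close>. If no two distinct elements of
  \<open>B\<close> agree \<open>l\<close>-almost everywhere, \<open>L\<close> is determined by \<open>S\<close>, \<open>l\<close> and \<open>B\<close>.\<close>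

definition transfer_operator_on ::
  "('y::topological_space \<Rightarrow> 'y) \<Rightarrow> 'y measure \<Rightarrow> ('y \<Rightarrow> real) set \<Rightarrow> (('y \<Rightarrow> real) \<Rightarrow> real)
     \<Rightarrow> (('y \<Rightarrow> real) \<Rightarrow> ('y \<Rightarrow> real)) \<Rightarrow> bool" where
  "transfer_operator_on S l B N L \<longleftrightarrow>
     (\<forall>f\<in>B. L f \<in> B \<and> transfer_version S l f (L f)) \<and>
     (\<forall>f\<in>B. \<forall>g\<in>B. L (\<lambda>y. f y + g y) = (\<lambda>y. L f y + L g y)) \<and>
     (\<forall>c. \<forall>f\<in>B. L (\<lambda>y. c * f y) = (\<lambda>y. c * L f y)) \<and>
     (\<exists>M. \<forall>f\<in>B. N (L f) \<le> M * N f)"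

text \<open>\<open>h\<close> is the normalized eigenfunction.\<close>

definition has_spectral_gap ::
  "('y::topological_space \<Rightarrow> 'y) \<Rightarrow> 'y measure \<Rightarrow> ('y \<Rightarrow> real) set \<Rightarrow> (('y \<Rightarrow> real) \<Rightarrow> real)
     \<Rightarrow> ('y \<Rightarrow> real) \<Rightarrow> bool" where
  "has_spectral_gap S l B N h \<longleftrightarrow>
     (\<exists>L. transfer_operator_on S l B N L \<and>
        h \<in> B \<and> (\<forall>y. 0 < h y) \<and> L h = h \<and> (LINT y|l. h y) = 1 \<and>
        (\<exists>C\<ge>1. \<exists>\<delta>. 0 < \<delta> \<and> \<delta> < 1 \<and>
           (\<forall>f\<in>B. (LINT y|l. f y) = 0 \<longrightarrow>
              (\<forall>n. N ((L ^^ n) f) \<le> C * (1 - \<delta>) ^ n * N f))))"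


subsection \<open>Wasserstein metric\<close>

definition couplings ::
  "'a::topological_space measure \<Rightarrow> 'a measure \<Rightarrow> ('a \<times> 'a) measure set" where
  "couplings \<mu>0 \<mu>1 =
     {\<gamma> \<in> borel_prob_measures. distr \<gamma> borel fst = \<mu>0 \<and> distr \<gamma> borel snd = \<mu>1}"

definition wasserstein :: "'a::metric_space measure \<Rightarrow> 'a measure \<Rightarrow> real" where
  "wasserstein \<mu>0 \<mu>1 = (INF \<gamma> \<in> couplings \<mu>0 \<mu>1. LINT z|\<gamma>. dist (fst z) (snd z))"

end

theory Submission
  imports Defs
begin

text \<open>
  The spectral gap makes the measures converge on the base in a strong sense. If \<open>\<nu>\<close> projects to
  \<open>f dl\<close>, then \<open>T\<^sup>k\<^sub>* \<nu>\<close> projects to \<open>(L\<^sup>k f) dl\<close>, and since \<open>f - h\<close> has integral zero and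
  the norm of \<open>B\<close> dominates the supremum norm, the density \<open>L\<^sup>k f\<close> is uniformly within
  \<open>O((1 - \<delta>)\<^sup>k)\<close> of \<open>h\<close>, the density of the projection of \<open>\<mu>\<close>. So almost all the mass of
  \<open>T\<^sup>k\<^sub>* \<nu>\<close> can be coupled with mass of \<open>\<mu>\<close> lying over the same place in \<open>Y\<close>, and only a
  proportion \<open>O((1 - \<delta>)\<^sup>k)\<close> has to be coupled arbitrarily. Applying \<open>T\<^sup>m\<close> then brings the two
  points of a well-coupled pair within \<open>O(\<theta>\<^sup>m)\<close>, because the fibers shrink, while the other
  pairs cost at most the diameter of \<open>X\<close>. Since \<open>\<mu>\<close> is invariant, this bounds the distance from
  \<open>T\<^sup>n\<^sub>* \<nu>\<close> to \<open>\<mu>\<close>, \<open>n = m + k\<close>, by \<open>O(\<theta>\<^sup>m + (1 - \<delta>)\<^sup>k)\<close>, which is exponentially small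
  for \<open>m\<close> and \<open>k\<close> close to \<open>n / 2\<close>.

  Coupling exactly along fibers would require disintegrating both measures over \<open>Y\<close>. Instead, \<open>Y\<close>
  is cut into finitely many small Borel cells, and the coupling is an explicit density on the
  product of the two measures, constant on pairs of preimages of cells
  (\<open>finite_coupling_weights\<close>, \<open>coupling_through_cells\<close>). Two points over the same cell lie in
  neighbouring fibers only, but for fixed \<open>m\<close> the continuity of \<open>T\<^sup>m\<close> and compactness extend the
  contraction to such pairs once the cells are small enough, at the price of a factor \<open>2\<close>
  (\<open>contraction_near_fibers\<close>). The proportion of badly coupled mass is bounded by the uniform
  distance of the densities for every partition (\<open>sum_pos_part_cells_le\<close>), so the cells may be
  chosen after \<open>m\<close>; \<open>wasserstein_lift_le\<close> collects the resulting estimate.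
\<close>

section \<open>Borel sets of compact metric spaces\<close>

lemma borel_prob_measures_iff:
  "\<alpha> \<in> borel_prob_measures \<longleftrightarrow> prob_space \<alpha> \<and> sets \<alpha> = sets borel"
  by (auto simp: space_prob_algebra)

text \<open>Finitely many balls of radius \<open>1 / Suc n\<close> cover the space for every \<open>n\<close>; together they form a
  countable base, so every open set of the square is a countable union of rectangles. Hence a
  measure built with a density on the product \<open>\<sigma>\<close>-algebra is a Borel measure.\<close>

lemma sets_borel_prod_compact:
  assumes "compact (UNIV :: 'x::metric_space set)"
  shows "sets (borel \<Otimes>\<^sub>M borel :: ('x \<times> 'x) measure) = sets borel"
proof
  show "sets (borel \<Otimes>\<^sub>M borel :: ('x \<times> 'x) measure) \<subseteq> sets borel"
  proof (rule sets_pair_in_sets)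
    fix A C :: "'x set" assume A: "A \<in> sets borel" and C: "C \<in> sets borel"
    have f: "(fst :: 'x \<times> 'x \<Rightarrow> 'x) \<in> borel \<rightarrow>\<^sub>M borel" "(snd :: 'x \<times> 'x \<Rightarrow> 'x) \<in> borel \<rightarrow>\<^sub>M borel"
      by (auto intro!: borel_measurable_continuous_onI continuous_intros)
    have "A \<times> C = (fst -` A \<inter> space borel) \<inter> (snd -` C \<inter> space borel)"
      by auto
    then show "A \<times> C \<in> sets (borel :: ('x \<times> 'x) measure)"
      using measurable_sets[OF f(1) A] measurable_sets[OF f(2) C] by auto
  qed
next
  have "\<exists>k. finite k \<and> (UNIV :: 'x set) \<subseteq> (\<Union>x\<in>k. ball x (1 / Suc n))" for n
    using compact_eq_totally_bounded[THEN iffD1, OF assms] by (auto dest!: spec[of _ "1 / Suc n"])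
  then obtain k where fin: "\<And>n. finite (k n)"
    and cov: "\<And>n. (UNIV :: 'x set) \<subseteq> (\<Union>x\<in>k n. ball x (1 / Suc n))"
    by metis
  define \<C> where "\<C> = (\<Union>n. (\<lambda>x. ball x (1 / Suc n)) ` k n)"
  have \<C>: "countable \<C>" unfolding \<C>_def using fin by (auto intro: countable_finite)
  have base: "\<exists>V\<in>\<C>. x \<in> V \<and> V \<subseteq> U" if U: "open U" "x \<in> U" for x :: 'x and U
  proof -
    obtain e where e: "e > 0" "ball x e \<subseteq> U" using openE[OF U] by blast
    obtain n where n: "1 / Suc n < e / 2"
      using e(1) nat_approx_posE[of "e/2"] by auto
    obtain c where c: "c \<in> k n" "x \<in> ball c (1 / Suc n)" using cov by blast
    have "ball c (1 / Suc n) \<subseteq> ball x e"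
    proof
      fix z assume "z \<in> ball c (1 / Suc n)"
      then have "dist x z < e" using n c(2) dist_triangle[of x z c] by (auto simp: dist_commute)
      then show "z \<in> ball x e" by simp
    qed
    then show ?thesis using e c unfolding \<C>_def by blast
  qed
  have "open U \<Longrightarrow> U \<in> sets (borel \<Otimes>\<^sub>M borel)" for U :: "('x \<times> 'x) set"
  proof -
    assume U: "open U"
    define \<D> where "\<D> = {(A, C). A \<in> \<C> \<and> C \<in> \<C> \<and> A \<times> C \<subseteq> U}"
    have "countable \<D>"
      by (rule countable_subset[of _ "\<C> \<times> \<C>"]) (auto simp: \<D>_def \<C>)
    moreover have "U = (\<Union>(A, C)\<in>\<D>. A \<times> C)"
    proof -
      have "\<exists>(A, C)\<in>\<D>. z \<in> A \<times> C" if z: "z \<in> U" for z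
      proof -
        obtain V W where VW: "open V" "open W" "z \<in> V \<times> W" "V \<times> W \<subseteq> U"
          using open_prod_elim[OF U z] by blast
        obtain A where A: "A \<in> \<C>" "fst z \<in> A" "A \<subseteq> V" using base[of V "fst z"] VW by auto
        obtain C where C: "C \<in> \<C>" "snd z \<in> C" "C \<subseteq> W" using base[of W "snd z"] VW by auto
        have "A \<times> C \<subseteq> U" using A C VW by blast
        then show ?thesis using A C unfolding \<D>_def by (intro bexI[of _ "(A, C)"]) (auto simp: mem_Times_iff)
      qed
      then show ?thesis unfolding \<D>_def by fastforce
    qed
    moreover have "A \<times> C \<in> sets (borel \<Otimes>\<^sub>M borel)" if "(A, C) \<in> \<D>" for A C
      using that unfolding \<D>_def \<C>_def by (auto intro!: pair_measureI)
    ultimately show ?thesis by (auto intro!: sets.countable_UN')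
  qed
  then have "{U. open U} \<subseteq> sets (borel \<Otimes>\<^sub>M borel :: ('x \<times> 'x) measure)" by blast
  from sets.sigma_sets_subset[OF this]
  show "sets borel \<subseteq> sets (borel \<Otimes>\<^sub>M borel :: ('x \<times> 'x) measure)"
    by (simp add: borel_def space_pair_measure)
qed

text \<open>Assigning to a point the first ball of a finite cover that contains it yields a finite Borel
  partition into cells of small diameter; \<open>I y\<close> is the index of the cell of \<open>y\<close>.\<close>

lemma compact_borel_cells:
  assumes "compact (UNIV :: 'y::metric_space set)" and "0 < \<epsilon>"
  obtains I :: "'y::metric_space \<Rightarrow> nat" and r where "\<And>y. I y < r" and "\<And>i. I -` {i} \<in> sets borel"
    and "\<And>y y'. I y = I y' \<Longrightarrow> dist y y' < \<epsilon>"
proof -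
  obtain k :: "'y set" where fin: "finite k" and cov: "UNIV \<subseteq> (\<Union>x\<in>k. ball x (\<epsilon>/2))"
    using compact_eq_totally_bounded[THEN iffD1, OF assms(1)] assms(2) by (meson half_gt_zero)
  obtain cs where cs: "set cs = k" using finite_list[OF fin] by blast
  define V where "V i = (if i < length cs then ball (cs ! i) (\<epsilon>/2) else {})" for i
  define I where "I y = (LEAST i. y \<in> V i)" for y
  have ex: "\<exists>i. y \<in> V i" for y
  proof -
    obtain c where "c \<in> set cs" "y \<in> ball c (\<epsilon>/2)" using cov cs by blast
    then show ?thesis unfolding V_def by (metis in_set_conv_nth)
  qed
  have I: "y \<in> V (I y)" for y unfolding I_def using ex by (rule LeastI_ex)
  have V: "open (V i)" for i by (simp add: V_def)
  show thesis
  proof (rule that[of I "length cs"])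
    show "I y < length cs" for y using I[of y] by (auto simp: V_def split: if_splits)
    show "I -` {i} \<in> sets borel" for i
    proof -
      have "I -` {i} = V i - (\<Union>j<i. V j)"
      proof (intro set_eqI iffI)
        fix y assume "y \<in> I -` {i}"
        then show "y \<in> V i - (\<Union>j<i. V j)" using I[of y] not_less_Least unfolding I_def by blast
      next
        fix y assume "y \<in> V i - (\<Union>j<i. V j)"
        then have "I y = i" unfolding I_def by (intro Least_equality) (auto simp: not_less[symmetric])
        then show "y \<in> I -` {i}" by simp
      qed
      then show ?thesis using V by auto
    qed
    show "dist y y' < \<epsilon>" if "I y = I y'" for y y'
    proof -
      have "dist (cs ! I y) y < \<epsilon>/2" "dist (cs ! I y) y' < \<epsilon>/2"
        using I[of y] I[of y'] that by (auto simp: V_def split: if_splits)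
      then show ?thesis using dist_triangle[of y y' "cs ! I y"] by (simp add: dist_commute)
    qed
  qed
qed

section \<open>Couplings through a finite partition\<close>

text \<open>The maximal coupling of two probability vectors \<open>a\<close> and \<open>b\<close> puts \<open>min (a i) (b i)\<close> on the
  diagonal and couples the excesses of \<open>a\<close> and of \<open>b\<close> independently, so its off-diagonal mass is
  at most the total excess. The numbers \<open>w i j\<close> are the densities of this coupling with respect
  to the product of \<open>a\<close> and \<open>b\<close>; in this form the coupling transports to spaces on which
  \<open>a\<close> and \<open>b\<close> are only the masses of cells.\<close>

lemma finite_coupling_weights:
  fixes a b :: "nat \<Rightarrow> real"
  assumes a: "\<And>i. 0 \<le> a i" "(\<Sum>i<r. a i) = 1" and b: "\<And>i. 0 \<le> b i" "(\<Sum>i<r. b i) = 1"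
  obtains w :: "nat \<Rightarrow> nat \<Rightarrow> real" where "\<And>i j. 0 \<le> w i j"
    and "\<And>i. i < r \<Longrightarrow> 0 < a i \<Longrightarrow> (\<Sum>j<r. w i j * b j) = 1"
    and "\<And>j. j < r \<Longrightarrow> 0 < b j \<Longrightarrow> (\<Sum>i<r. w i j * a i) = 1"
    and "(\<Sum>i<r. (\<Sum>j<r. (if i = j then 0 else w i j) * b j) * a i) \<le> (\<Sum>i<r. max 0 (a i - b i))"
proof -
  \<comment> \<open>\<open>m\<close> is the mass that stays in its cell, \<open>u\<close> and \<open>v\<close> are the fractions of \<open>a\<close> and \<open>b\<close> that
    have to move, and \<open>s\<close> is the total mass moved. When \<open>s = 0\<close> or a cell has mass \<open>0\<close>, the
    convention \<open>x / 0 = 0\<close> switches the corresponding term off.\<close>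
  define m where "m i = min (a i) (b i)" for i
  define u where "u i = (a i - m i) / a i" for i
  define v where "v i = (b i - m i) / b i" for i
  define s where "s = (\<Sum>i<r. a i - m i)"
  define w where "w i j = (if i = j then m i / (a i * b i) else 0) + u i * v j / s" for i j
  have m: "0 \<le> m i" "m i \<le> a i" "m i \<le> b i" for i using a b by (auto simp: m_def)
  have s0: "0 \<le> s" unfolding s_def using m by (intro sum_nonneg) auto
  have u0: "0 \<le> u i" "0 \<le> v i" for i using a(1)[of i] b(1)[of i] m[of i] by (auto simp: u_def v_def)
  have ua: "u i * a i = a i - m i" for i using m[of i] by (cases "a i = 0") (auto simp: u_def)
  have vb: "v i * b i = b i - m i" for i using m[of i] by (cases "b i = 0") (auto simp: v_def)
  have s': "s = (\<Sum>i<r. b i - m i)" unfolding s_def by (simp add: sum_subtractf a b)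
  have z: "a i = m i" "b i = m i" if "s = 0" "i < r" for i
    using that sum_nonneg_eq_0_iff[of "{..<r}" "\<lambda>i. a i - m i"] 
      sum_nonneg_eq_0_iff[of "{..<r}" "\<lambda>i. b i - m i"] m s_def s' by auto
  show thesis
  proof (rule that[of w])
    show w0: "0 \<le> w i j" for i j unfolding w_def using a b m u0 s0 by auto
    show "(\<Sum>j<r. w i j * b j) = 1" if i: "i < r" "0 < a i" for i
    proof -
      have "(\<Sum>j<r. w i j * b j)
          = (\<Sum>j<r. if i = j then m i / (a i * b i) * b i else 0) + (\<Sum>j<r. u i / s * (v j * b j))"
        unfolding w_def sum.distrib[symmetric] by (intro sum.cong) (auto simp: algebra_simps)
      also have "\<dots> = m i / (a i * b i) * b i + u i / s * s"
        unfolding sum_distrib_left[symmetric] vb s'[symmetric] using i by simp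
      also have "m i / (a i * b i) * b i = m i / a i"
        using m[of i] by (cases "b i = 0") auto
      also have "m i / a i + u i / s * s = 1"
        using z(1)[of i] i by (cases "s = 0") (auto simp: u_def field_simps)
      finally show ?thesis .
    qed
    show "(\<Sum>i<r. w i j * a i) = 1" if j: "j < r" "0 < b j" for j
    proof -
      have "(\<Sum>i<r. w i j * a i)
          = (\<Sum>i<r. if i = j then m j / (a j * b j) * a j else 0) + (\<Sum>i<r. v j / s * (u i * a i))"
        unfolding w_def sum.distrib[symmetric] by (intro sum.cong) (auto simp: algebra_simps)
      also have "\<dots> = m j / (a j * b j) * a j + v j / s * s"
        unfolding sum_distrib_left[symmetric] ua s_def[symmetric] using j by simp
      also have "m j / (a j * b j) * a j = m j / b j"
        using m[of j] by (cases "a j = 0") auto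
      also have "m j / b j + v j / s * s = 1"
        using z(2)[of j] j by (cases "s = 0") (auto simp: v_def field_simps)
      finally show ?thesis .
    qed
    have "(\<Sum>i<r. (\<Sum>j<r. (if i = j then 0 else w i j) * b j) * a i)
        \<le> (\<Sum>i<r. (\<Sum>j<r. u i * v j / s * b j) * a i)"
      using a b u0 s0 by (intro sum_mono mult_right_mono) (auto simp: w_def)
    also have "\<dots> = (\<Sum>i<r. (u i * a i) * (\<Sum>j<r. v j * b j) / s)"
      by (intro sum.cong) (auto simp: sum_distrib_left sum_distrib_right sum_divide_distrib mult_ac)
    also have "\<dots> = (\<Sum>i<r. (a i - m i)) * s / s"
      by (simp add: ua vb s'[symmetric] sum_distrib_right sum_divide_distrib)
    also have "\<dots> = (\<Sum>i<r. a i - m i)" using s_def by (cases "s = 0") auto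
    also have "\<dots> = (\<Sum>i<r. max 0 (a i - b i))"
      by (intro sum.cong) (auto simp: m_def min_def max_def)
    finally show "(\<Sum>i<r. (\<Sum>j<r. (if i = j then 0 else w i j) * b j) * a i)
      \<le> (\<Sum>i<r. max 0 (a i - b i))" .
  qed
qed

lemma nn_integral_cells:
  fixes J :: "'x::topological_space \<Rightarrow> nat"
  assumes "\<beta> \<in> borel_prob_measures" and J: "\<And>x. J x < r" "\<And>i. J -` {i} \<in> sets borel"
    and \<phi>: "\<And>i. 0 \<le> \<phi> i"
  shows "(\<integral>\<^sup>+x. ennreal (\<phi> (J x)) \<partial>\<beta>) = ennreal (\<Sum>i<r. \<phi> i * measure \<beta> (J -` {i}))"
proof -
  have s: "sets \<beta> = sets borel" and "prob_space \<beta>" using assms(1) borel_prob_measures_iff by auto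
  then interpret prob_space \<beta> by simp
  have "(\<integral>\<^sup>+x. ennreal (\<phi> (J x)) \<partial>\<beta>) = (\<integral>\<^sup>+x. (\<Sum>i<r. ennreal (\<phi> i) * indicator (J -` {i}) x) \<partial>\<beta>)"
  proof (intro nn_integral_cong)
    fix x
    have "(\<Sum>i<r. ennreal (\<phi> i) * indicator (J -` {i}) x) = (\<Sum>i<r. if i = J x then ennreal (\<phi> i) else 0)"
      by (intro sum.cong) auto
    then show "ennreal (\<phi> (J x)) = (\<Sum>i<r. ennreal (\<phi> i) * indicator (J -` {i}) x)"
      using J(1) by simp
  qed
  also have "\<dots> = (\<Sum>i<r. ennreal (\<phi> i) * emeasure \<beta> (J -` {i}))"
    using J(2) s by (subst nn_integral_sum) (auto simp: nn_integral_cmult_indicator)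
  also have "\<dots> = ennreal (\<Sum>i<r. \<phi> i * measure \<beta> (J -` {i}))"
    using \<phi> by (subst sum_ennreal[symmetric]) (auto simp: ennreal_mult' emeasure_eq_measure)
  finally show ?thesis .
qed

lemma sum_measure_cells:
  fixes J :: "'x::topological_space \<Rightarrow> nat"
  assumes "\<beta> \<in> borel_prob_measures" and J: "\<And>x. J x < r" "\<And>i. J -` {i} \<in> sets borel"
  shows "(\<Sum>i<r. measure \<beta> (J -` {i})) = 1"
proof -
  interpret prob_space \<beta> using assms(1) borel_prob_measures_iff by auto
  have "ennreal (\<Sum>i<r. measure \<beta> (J -` {i})) = 1"
    using nn_integral_cells[OF assms, of "\<lambda>_. 1"] by (simp add: emeasure_space_1)
  then show ?thesis by simp
qed

lemma AE_cell_positive: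
  fixes J :: "'x::topological_space \<Rightarrow> nat"
  assumes "\<beta> \<in> borel_prob_measures" and J: "\<And>i. J -` {i} \<in> sets borel"
  shows "AE x in \<beta>. 0 < measure \<beta> (J -` {J x})"
proof -
  have s: "sets \<beta> = sets borel" and "prob_space \<beta>" using assms(1) borel_prob_measures_iff by auto
  then interpret prob_space \<beta> by simp
  have "AE x in \<beta>. \<forall>i. 0 < measure \<beta> (J -` {i}) \<or> x \<notin> J -` {i}"
    unfolding AE_all_countable
  proof
    fix i show "AE x in \<beta>. 0 < measure \<beta> (J -` {i}) \<or> x \<notin> J -` {i}"
    proof (cases "0 < measure \<beta> (J -` {i})")
      case False
      then have "emeasure \<beta> (J -` {i}) = 0"
        using measure_nonneg[of \<beta> "J -` {i}"] by (auto simp: emeasure_eq_measure)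
      then show ?thesis using J[of i] s by (intro AE_I[of _ _ "J -` {i}"]) auto
    qed simp
  qed
  then show ?thesis by eventually_elim auto
qed

text \<open>The maximal coupling of the cell masses is lifted by giving the product measure a density
  that depends only on the two cells. This replaces a disintegration of the two measures along
  the map whose fibers the cells approximate: the pairs in a common cell are not in a common
  fiber, only in neighbouring ones, and in exchange the coupling is explicit.\<close>

lemma coupling_through_cells:
  fixes \<alpha> \<beta> :: "'x::metric_space measure" and J :: "'x \<Rightarrow> nat"
  assumes X: "compact (UNIV :: 'x set)"
    and \<alpha>: "\<alpha> \<in> borel_prob_measures" and \<beta>: "\<beta> \<in> borel_prob_measures"
    and J: "\<And>x. J x < r" "\<And>i. J -` {i} \<in> sets borel"
  obtains \<gamma> where "\<gamma> \<in> couplings \<alpha> \<beta>" and "{z. J (fst z) \<noteq> J (snd z)} \<in> sets borel"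
    and "measure \<gamma> {z. J (fst z) \<noteq> J (snd z)}
           \<le> (\<Sum>i<r. max 0 (measure \<alpha> (J -` {i}) - measure \<beta> (J -` {i})))"
proof -
  define a where "a i = measure \<alpha> (J -` {i})" for i
  define b where "b i = measure \<beta> (J -` {i})" for i
  have s\<alpha>[measurable_cong]: "sets \<alpha> = sets borel" and s\<beta>[measurable_cong]: "sets \<beta> = sets borel"
    using \<alpha> \<beta> borel_prob_measures_iff by auto
  interpret A: prob_space \<alpha> using \<alpha> borel_prob_measures_iff by auto
  interpret B: prob_space \<beta> using \<beta> borel_prob_measures_iff by auto
  interpret P: pair_prob_space \<alpha> \<beta> ..
  have sp: "space \<alpha> = UNIV" "space \<beta> = UNIV" using s\<alpha> s\<beta> by (auto dest: sets_eq_imp_space_eq)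
  have sP: "sets (\<alpha> \<Otimes>\<^sub>M \<beta>) = sets borel"
    using sets_borel_prod_compact[OF X] sets_pair_measure_cong[OF s\<alpha> s\<beta>] by simp
  have Jm[measurable]: "J \<in> borel \<rightarrow>\<^sub>M count_space UNIV"
    using J(2) by (intro measurable_count_space_eq2_countable[THEN iffD2]) auto
  obtain w where w0: "\<And>i j. 0 \<le> w i j"
    and wb: "\<And>i. i < r \<Longrightarrow> 0 < a i \<Longrightarrow> (\<Sum>j<r. w i j * b j) = 1"
    and wa: "\<And>j. j < r \<Longrightarrow> 0 < b j \<Longrightarrow> (\<Sum>i<r. w i j * a i) = 1"
    and off: "(\<Sum>i<r. (\<Sum>j<r. (if i = j then 0 else w i j) * b j) * a i)
          \<le> (\<Sum>i<r. max 0 (a i - b i))"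
  proof (rule finite_coupling_weights[of a r b])
    show "(\<Sum>i<r. a i) = 1" "(\<Sum>i<r. b i) = 1"
      using sum_measure_cells[OF \<alpha> J] sum_measure_cells[OF \<beta> J] by (simp_all add: a_def b_def)
  qed (auto simp: a_def b_def)
  define g where "g z = ennreal (w (J (fst z)) (J (snd z)))" for z :: "'x \<times> 'x"
  have g[measurable]: "g \<in> borel_measurable (\<alpha> \<Otimes>\<^sub>M \<beta>)"
    unfolding g_def by measurable
  define \<gamma> where "\<gamma> = density (\<alpha> \<Otimes>\<^sub>M \<beta>) g"
  have s\<gamma>: "sets \<gamma> = sets borel" by (simp add: \<gamma>_def sP)
  have sp\<gamma>: "space \<gamma> = UNIV" using s\<gamma> by (auto dest: sets_eq_imp_space_eq)
  have fs: "fst \<in> \<gamma> \<rightarrow>\<^sub>M borel" "snd \<in> \<gamma> \<rightarrow>\<^sub>M borel"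
    unfolding measurable_cong_sets[OF s\<gamma> refl]
    by (auto intro!: borel_measurable_continuous_onI continuous_intros)
  have pos\<alpha>: "AE x in \<alpha>. 0 < a (J x)" and pos\<beta>: "AE x in \<beta>. 0 < b (J x)"
    using AE_cell_positive[OF \<alpha> J(2)] AE_cell_positive[OF \<beta> J(2)] by (simp_all add: a_def b_def)
  have m1: "distr \<gamma> borel fst = \<alpha>"
  proof (rule measure_eqI)
    fix E assume "E \<in> sets (distr \<gamma> borel fst)"
    then have E[measurable]: "E \<in> sets borel" by simp
    have "emeasure (distr \<gamma> borel fst) E = emeasure \<gamma> (fst -` E)"
      using fs E sp\<gamma> by (simp add: emeasure_distr)
    also have "\<dots> = (\<integral>\<^sup>+z. g z * indicator (fst -` E) z \<partial>(\<alpha> \<Otimes>\<^sub>M \<beta>))"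
      unfolding \<gamma>_def using measurable_sets[OF fs(1) E] s\<gamma> sp\<gamma> sP
      by (subst emeasure_density) auto
    also have "\<dots> = (\<integral>\<^sup>+z. g z * indicator E (fst z) \<partial>(\<alpha> \<Otimes>\<^sub>M \<beta>))"
      by (intro nn_integral_cong) (auto simp: indicator_def)
    also have "\<dots> = (\<integral>\<^sup>+x. \<integral>\<^sup>+y. ennreal (w (J x) (J y)) * indicator E x \<partial>\<beta> \<partial>\<alpha>)"
      by (subst B.nn_integral_fst[symmetric]) (auto simp: g_def)
    also have "\<dots> = (\<integral>\<^sup>+x. ennreal (\<Sum>j<r. w (J x) j * b j) * indicator E x \<partial>\<alpha>)"
      using nn_integral_cells[OF \<beta> J, of "\<lambda>j. w (J x) j" for x] w0
      by (intro nn_integral_cong) (subst nn_integral_multc, auto simp: b_def)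
    also have "\<dots> = (\<integral>\<^sup>+x. indicator E x \<partial>\<alpha>)"
    proof (rule nn_integral_cong_AE)
      show "AE x in \<alpha>. ennreal (\<Sum>j<r. w (J x) j * b j) * indicator E x = indicator E x"
        using pos\<alpha> by eventually_elim (simp add: wb J)
    qed
    finally show "emeasure (distr \<gamma> borel fst) E = emeasure \<alpha> E" using E s\<alpha> by simp
  qed (simp add: s\<alpha>)
  have m2: "distr \<gamma> borel snd = \<beta>"
  proof (rule measure_eqI)
    fix E assume "E \<in> sets (distr \<gamma> borel snd)"
    then have E[measurable]: "E \<in> sets borel" by simp
    have "emeasure (distr \<gamma> borel snd) E = emeasure \<gamma> (snd -` E)"
      using fs E sp\<gamma> by (simp add: emeasure_distr)
    also have "\<dots> = (\<integral>\<^sup>+z. g z * indicator (snd -` E) z \<partial>(\<alpha> \<Otimes>\<^sub>M \<beta>))"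
      unfolding \<gamma>_def using measurable_sets[OF fs(2) E] s\<gamma> sp\<gamma> sP
      by (subst emeasure_density) auto
    also have "\<dots> = (\<integral>\<^sup>+z. g z * indicator E (snd z) \<partial>(\<alpha> \<Otimes>\<^sub>M \<beta>))"
      by (intro nn_integral_cong) (auto simp: indicator_def)
    also have "\<dots> = (\<integral>\<^sup>+y. \<integral>\<^sup>+x. ennreal (w (J x) (J y)) * indicator E y \<partial>\<alpha> \<partial>\<beta>)"
      using P.nn_integral_snd[of "\<lambda>z. g z * indicator E (snd z)"] 
      by (simp add: g_def case_prod_beta')
    also have "\<dots> = (\<integral>\<^sup>+y. ennreal (\<Sum>i<r. w i (J y) * a i) * indicator E y \<partial>\<beta>)"
      using nn_integral_cells[OF \<alpha> J, of "\<lambda>i. w i (J y)" for y] w0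
      by (intro nn_integral_cong) (subst nn_integral_multc, auto simp: a_def)
    also have "\<dots> = (\<integral>\<^sup>+y. indicator E y \<partial>\<beta>)"
    proof (rule nn_integral_cong_AE)
      show "AE x in \<beta>. ennreal (\<Sum>i<r. w i (J x) * a i) * indicator E x = indicator E x"
        using pos\<beta> by eventually_elim (simp add: wa J)
    qed
    finally show "emeasure (distr \<gamma> borel snd) E = emeasure \<beta> E" using E s\<beta> by simp
  qed (simp add: s\<beta>)
  have "prob_space (distr \<gamma> borel fst)" using m1 A.prob_space_axioms by simp
  then have p\<gamma>: "prob_space \<gamma>" by (rule prob_space_distrD[OF fs(1)])
  define Off where "Off = {z. J (fst z) \<noteq> J (snd z)}"
  have Off_eq: "Off = space (\<alpha> \<Otimes>\<^sub>M \<beta>) - (\<Union>i. J -` {i} \<times> J -` {i})"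
    by (auto simp: space_pair_measure sp Off_def)
  have "J -` {i} \<times> J -` {i} \<in> sets (\<alpha> \<Otimes>\<^sub>M \<beta>)" for i
    using J(2) s\<alpha> s\<beta> by (intro pair_measureI) simp_all
  then have "(\<Union>i. J -` {i} \<times> J -` {i}) \<in> sets (\<alpha> \<Otimes>\<^sub>M \<beta>)"
    by (intro sets.countable_UN') blast+
  then have Off: "Off \<in> sets (\<alpha> \<Otimes>\<^sub>M \<beta>)"
    unfolding Off_eq by (rule sets.compl_sets)
  \<comment> \<open>\<open>\<phi> i\<close> is the fraction of the mass of cell \<open>i\<close> that is sent to other cells.\<close>
  define \<phi> where "\<phi> i = (\<Sum>j<r. (if i = j then 0 else w i j) * b j)" for i
  have \<phi>0: "0 \<le> \<phi> i" for i unfolding \<phi>_def using w0 by (intro sum_nonneg) (auto simp: b_def)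
  have "emeasure \<gamma> Off = (\<integral>\<^sup>+z. g z * indicator Off z \<partial>(\<alpha> \<Otimes>\<^sub>M \<beta>))"
    unfolding \<gamma>_def using Off by (subst emeasure_density) auto
  also have "\<dots> = (\<integral>\<^sup>+x. \<integral>\<^sup>+y. ennreal (if J x = J y then 0 else w (J x) (J y)) \<partial>\<beta> \<partial>\<alpha>)"
    using Off by (subst B.nn_integral_fst[symmetric]) (auto simp: g_def Off_def intro!: nn_integral_cong)
  also have "\<dots> = (\<integral>\<^sup>+x. ennreal (\<phi> (J x)) \<partial>\<alpha>)"
    using nn_integral_cells[OF \<beta> J, of "\<lambda>j. if J x = j then 0 else w (J x) j" for x] w0
    by (intro nn_integral_cong) (simp add: \<phi>_def b_def)
  also have "\<dots> = ennreal (\<Sum>i<r. \<phi> i * a i)"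
    using nn_integral_cells[OF \<alpha> J, of \<phi>] \<phi>0 by (simp add: a_def)
  also have "\<dots> \<le> ennreal (\<Sum>i<r. max 0 (a i - b i))"
    using off unfolding \<phi>_def by (rule ennreal_leI)
  finally have "measure \<gamma> Off \<le> (\<Sum>i<r. max 0 (a i - b i))"
    unfolding measure_def by (intro enn2real_leI) (auto intro!: sum_nonneg)
  moreover have "\<gamma> \<in> couplings \<alpha> \<beta>"
    unfolding couplings_def using m1 m2 p\<gamma> s\<gamma> borel_prob_measures_iff by blast
  ultimately show thesis
    using that[of \<gamma>] Off sP unfolding Off_def a_def b_def by blast
qed


section \<open>Wasserstein distance of push-forwards\<close>

lemma wasserstein_le_coupling:
  assumes "\<gamma> \<in> couplings \<alpha> \<beta>"
  shows "wasserstein \<alpha> \<beta> \<le> (LINT z|\<gamma>. dist (fst z) (snd z))"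
  unfolding wasserstein_def using assms
  by (intro cINF_lower) (auto intro!: bdd_belowI2[of _ 0] integral_nonneg)

lemma borel_measurable_map_prod:
  fixes F :: "'x::metric_space \<Rightarrow> 'x"
  assumes F: "continuous_on UNIV F"
  shows "map_prod F F \<in> borel \<rightarrow>\<^sub>M borel"
  unfolding map_prod_def case_prod_beta
  by (intro borel_measurable_continuous_onI continuous_intros continuous_on_compose2[OF F]) auto

lemma coupling_distr:
  fixes F :: "'x::metric_space \<Rightarrow> 'x"
  assumes F: "continuous_on UNIV F" and \<gamma>: "\<gamma> \<in> couplings \<alpha> \<beta>"
  shows "distr \<gamma> borel (map_prod F F) \<in> couplings (distr \<alpha> borel F) (distr \<beta> borel F)"
proof -
  have s\<gamma>: "sets \<gamma> = sets borel" and p: "prob_space \<gamma>"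
    and m: "distr \<gamma> borel fst = \<alpha>" "distr \<gamma> borel snd = \<beta>"
    using \<gamma> unfolding couplings_def borel_prob_measures_iff by auto
  have Fm: "F \<in> borel \<rightarrow>\<^sub>M borel" using F by (rule borel_measurable_continuous_onI)
  have FFm: "map_prod F F \<in> \<gamma> \<rightarrow>\<^sub>M borel"
    unfolding measurable_cong_sets[OF s\<gamma> refl] by (rule borel_measurable_map_prod[OF F])
  have f: "(fst :: 'x \<times> 'x \<Rightarrow> 'x) \<in> borel \<rightarrow>\<^sub>M borel" "(snd :: 'x \<times> 'x \<Rightarrow> 'x) \<in> borel \<rightarrow>\<^sub>M borel"
    by (auto intro!: borel_measurable_continuous_onI continuous_intros)
  then have f\<gamma>: "fst \<in> \<gamma> \<rightarrow>\<^sub>M borel" "snd \<in> \<gamma> \<rightarrow>\<^sub>M borel"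
    unfolding measurable_cong_sets[OF s\<gamma> refl] by auto
  have "distr (distr \<gamma> borel (map_prod F F)) borel fst = distr \<alpha> borel F"
    unfolding m(1)[symmetric] distr_distr[OF f(1) FFm] distr_distr[OF Fm f\<gamma>(1)]
    by (simp add: comp_def map_prod_def case_prod_beta)
  moreover have "distr (distr \<gamma> borel (map_prod F F)) borel snd = distr \<beta> borel F"
    unfolding m(2)[symmetric] distr_distr[OF f(2) FFm] distr_distr[OF Fm f\<gamma>(2)]
    by (simp add: comp_def map_prod_def case_prod_beta)
  ultimately show ?thesis
    unfolding couplings_def borel_prob_measures_iff
    using prob_space.prob_space_distr[OF p FFm] by simp
qed

text \<open>Pairs in a common cell cost at most \<open>c\<close> after applying \<open>F\<close>; the other pairs, whose mass is
  at most the excess of the cell masses, cost at most the diameter of the space.\<close>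

lemma wasserstein_distr_le_cells:
  fixes F :: "'x::metric_space \<Rightarrow> 'x" and J :: "'x \<Rightarrow> nat"
  assumes X: "compact (UNIV :: 'x set)"
    and \<alpha>: "\<alpha> \<in> borel_prob_measures" and \<beta>: "\<beta> \<in> borel_prob_measures"
    and J: "\<And>x. J x < r" "\<And>i. J -` {i} \<in> sets borel"
    and F: "continuous_on UNIV F"
    and close: "\<And>x x'. J x = J x' \<Longrightarrow> dist (F x) (F x') \<le> c" and c: "0 \<le> c"
    and D: "\<And>x x' :: 'x. dist x x' \<le> D"
  shows "wasserstein (distr \<alpha> borel F) (distr \<beta> borel F)
           \<le> c + D * (\<Sum>i<r. max 0 (measure \<alpha> (J -` {i}) - measure \<beta> (J -` {i})))"
proof -
  obtain \<gamma> where \<gamma>: "\<gamma> \<in> couplings \<alpha> \<beta>"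
    and bad: "{z. J (fst z) \<noteq> J (snd z)} \<in> sets borel" (is "?bad \<in> _")
    and off: "measure \<gamma> {z. J (fst z) \<noteq> J (snd z)}
           \<le> (\<Sum>i<r. max 0 (measure \<alpha> (J -` {i}) - measure \<beta> (J -` {i})))"
    by (rule coupling_through_cells[OF X \<alpha> \<beta> J])
  have s\<gamma>: "sets \<gamma> = sets borel" and p: "prob_space \<gamma>"
    using \<gamma> unfolding couplings_def borel_prob_measures_iff by auto
  interpret prob_space \<gamma> by (rule p)
  have D0: "0 \<le> D" using D[of undefined undefined] by simp
  have FFm: "map_prod F F \<in> \<gamma> \<rightarrow>\<^sub>M borel"
    unfolding measurable_cong_sets[OF s\<gamma> refl] by (rule borel_measurable_map_prod[OF F])
  have dm: "(\<lambda>z. dist (fst z) (snd z)) \<in> borel_measurable (borel :: ('x \<times> 'x) measure)"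
    by (auto intro!: borel_measurable_continuous_onI continuous_intros)
  have "wasserstein (distr \<alpha> borel F) (distr \<beta> borel F)
      \<le> (LINT z|distr \<gamma> borel (map_prod F F). dist (fst z) (snd z))"
    by (rule wasserstein_le_coupling[OF coupling_distr[OF F \<gamma>]])
  also have "\<dots> = (LINT z|\<gamma>. dist (F (fst z)) (F (snd z)))"
    by (subst integral_distr[OF FFm dm]) (simp add: map_prod_def case_prod_beta)
  also have "\<dots> \<le> (LINT z|\<gamma>. c + D * indicator ?bad z)"
  proof (rule integral_mono)
    show "integrable \<gamma> (\<lambda>z. c + D * indicator ?bad z)" using bad s\<gamma>
      by (intro Bochner_Integration.integrable_add integrable_mult_right integrable_real_indicator) 
        (auto simp: less_top[symmetric])
    have "(\<lambda>z. dist (F (fst z)) (F (snd z))) \<in> borel_measurable \<gamma>"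
      using measurable_compose[OF FFm dm] by (simp add: map_prod_def case_prod_beta)
    then show "integrable \<gamma> (\<lambda>z. dist (F (fst z)) (F (snd z)))"
      using D by (intro integrable_const_bound[of _ D]) auto
    show "dist (F (fst z)) (F (snd z)) \<le> c + D * indicator ?bad z" for z
      using D[of "F (fst z)" "F (snd z)"] close[of "fst z" "snd z"] c D0 by (auto simp: indicator_def)
  qed
  also have "\<dots> = c + D * measure \<gamma> ?bad"
    using bad s\<gamma> by (subst Bochner_Integration.integral_add) (auto simp: prob_space less_top[symmetric])
  also have "\<dots> \<le> c + D * (\<Sum>i<r. max 0 (measure \<alpha> (J -` {i}) - measure \<beta> (J -` {i})))"
    using off D0 by (intro add_left_mono mult_left_mono)
  finally show ?thesis .
qed

section \<open>Contraction between neighbouring fibers\<close>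

text \<open>The pairs that \<open>F\<close> leaves at distance at least \<open>c\<close> form a compact set on which the distance of
  the projections never vanishes, so this distance has a positive minimum. A strict contraction
  along fibers therefore persists between neighbouring fibers, which makes it usable with the
  approximate fibers given by a partition into small cells.\<close>

lemma contraction_near_fibers:
  fixes p :: "'x::metric_space \<Rightarrow> 'y::metric_space" and F :: "'x \<Rightarrow> 'x"
  assumes X: "compact (UNIV :: 'x set)" and p: "continuous_on UNIV p" and F: "continuous_on UNIV F"
    and fib: "\<And>x x'. p x = p x' \<Longrightarrow> dist (F x) (F x') < c"
  obtains \<epsilon> where "0 < \<epsilon>" and "\<And>x x'. dist (p x) (p x') < \<epsilon> \<Longrightarrow> dist (F x) (F x') < c"
proof -
  define K where "K = {z. c \<le> dist (F (fst z)) (F (snd z))}"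
  have "closed K" unfolding K_def
    by (intro closed_Collect_le continuous_intros continuous_on_compose2[OF F]) auto
  then have K: "compact K"
    using compact_Times[OF X X] compact_Int_closed[of UNIV K] by simp
  have cont: "continuous_on K (\<lambda>z. dist (p (fst z)) (p (snd z)))"
    by (intro continuous_intros continuous_on_compose2[OF p]) auto
  show thesis
  proof (cases "K = {}")
    case True
    then have "dist (F x) (F x') < c" for x x' 
      unfolding K_def by (metis (mono_tags, lifting) empty_Collect_eq fst_conv not_le snd_conv)
    then show thesis by (intro that[of 1]) auto
  next
    case False
    then obtain w where w: "w \<in> K" 
      "\<And>z. z \<in> K \<Longrightarrow> dist (p (fst w)) (p (snd w)) \<le> dist (p (fst z)) (p (snd z))"
      using continuous_attains_inf[OF K _ cont] by blast
    show thesis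
    proof (rule that[of "dist (p (fst w)) (p (snd w))"])
      show "0 < dist (p (fst w)) (p (snd w))"
        using w(1) fib[of "fst w" "snd w"] unfolding K_def by fastforce
      show "dist (F x) (F x') < c" if "dist (p x) (p x') < dist (p (fst w)) (p (snd w))" for x x'
        using w(2)[of "(x, x')"] that unfolding K_def by fastforce
    qed
  qed
qed

section \<open>Projections to the base and their densities\<close>

text \<open>Iterating \<open>S\<^sub>*(f dl) = (L f) dl\<close> with the test set pulled back one step at a time.\<close>

lemma transfer_version_funpow:
  assumes S: "S \<in> borel \<rightarrow>\<^sub>M borel"
    and L: "\<And>g. g \<in> B \<Longrightarrow> L g \<in> B \<and> transfer_version S l g (L g)" and f: "f \<in> B"
    and A: "A \<in> sets borel"
  shows "(LINT y:(S ^^ k) -` A|l. f y) = (LINT y:A|l. (L ^^ k) f y)"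
  using A
proof (induction k arbitrary: A)
  case (Suc k)
  have "S -` A \<in> sets borel" using measurable_sets[OF S Suc.prems] by simp
  moreover have "(L ^^ k) f \<in> B" using f L by (induction k) auto
  then have "transfer_version S l ((L ^^ k) f) (L ((L ^^ k) f))" using L by blast
  ultimately show ?case
    using Suc.IH[of "S -` A"] Suc.prems by (simp add: vimage_comp comp_def transfer_version_def)
qed simp

lemma measure_lift_eq:
  assumes p: "p \<in> \<nu> \<rightarrow>\<^sub>M borel" and A: "A \<in> sets borel" and l: "sets l = sets borel"
    and f: "integrable l f" "AE y in l. 0 \<le> f y"
    and d: "distr \<nu> borel p = density l (\<lambda>y. ennreal (f y))"
  shows "measure \<nu> (p -` A \<inter> space \<nu>) = (LINT y:A|l. f y)"
proof -
  have i: "integrable l (\<lambda>y. indicator A y * f y)"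
    using f(1) A l integrable_mult_indicator[of A l f] by simp
  have "emeasure \<nu> (p -` A \<inter> space \<nu>) = emeasure (density l (\<lambda>y. ennreal (f y))) A"
    using emeasure_distr[OF p A] d by simp
  also have "\<dots> = (\<integral>\<^sup>+y. ennreal (indicator A y * f y) \<partial>l)"
    using f A l by (subst emeasure_density) 
      (auto intro!: nn_integral_cong simp: indicator_def ennreal_mult')
  also have "\<dots> = ennreal (LINT y:A|l. f y)"
    using i f(2) by (subst nn_integral_eq_integral) (auto simp: set_lebesgue_integral_def)
  finally have "emeasure \<nu> (p -` A \<inter> space \<nu>) = ennreal (LINT y:A|l. f y)" .
  moreover have "0 \<le> (LINT y:A|l. f y)"
    unfolding set_lebesgue_integral_def
  proof (rule integral_nonneg_AE)
    show "AE y in l. 0 \<le> indicat_real A y *\<^sub>R f y" using f(2) by eventually_elim simp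
  qed
  ultimately show ?thesis
    unfolding measure_def by (simp only: enn2real_ennreal)
qed

text \<open>The excess on a cell is at most \<open>\<epsilon>\<close> times the \<open>l\<close>-mass of the cell, and these masses add up
  to \<open>1\<close>; so refining the partition does not spoil the bound. It is applied with \<open>g\<close> the
  difference of two densities.\<close>

lemma sum_pos_part_cells_le:
  fixes I :: "'y::topological_space \<Rightarrow> nat" and g :: "'y \<Rightarrow> real"
  assumes l: "l \<in> borel_prob_measures" and I: "\<And>y. I y < r" "\<And>i. I -` {i} \<in> sets borel"
    and g: "integrable l g" "\<And>y. \<bar>g y\<bar> \<le> \<epsilon>"
  shows "(\<Sum>i<r. max 0 (LINT y:I -` {i}|l. g y)) \<le> \<epsilon>"
proof -
  have s: "sets l = sets borel" and "prob_space l" using l borel_prob_measures_iff by auto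
  then interpret prob_space l by simp
  have e: "0 \<le> \<epsilon>" using g(2)[of undefined] by linarith
  have "(LINT y:I -` {i}|l. g y) \<le> \<epsilon> * measure l (I -` {i})" for i
  proof -
    have "(LINT y:I -` {i}|l. g y) \<le> (LINT y|l. \<epsilon> * indicator (I -` {i}) y)"
      unfolding set_lebesgue_integral_def
    proof (rule integral_mono)
      show "integrable l (\<lambda>y. indicat_real (I -` {i}) y *\<^sub>R g y)"
        using g(1) I(2) s by (intro integrable_mult_indicator) auto
      show "integrable l (\<lambda>y. \<epsilon> * indicat_real (I -` {i}) y)" using I(2) s
        by (intro integrable_mult_right integrable_real_indicator) (auto simp: less_top[symmetric])
      show "indicat_real (I -` {i}) y *\<^sub>R g y \<le> \<epsilon> * indicat_real (I -` {i}) y" for y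
        using g(2)[of y] by (auto simp: indicator_def)
    qed
    also have "\<dots> = \<epsilon> * measure l (I -` {i})" using I(2) s by simp
    finally show ?thesis .
  qed
  then have "(\<Sum>i<r. max 0 (LINT y:I -` {i}|l. g y)) \<le> (\<Sum>i<r. \<epsilon> * measure l (I -` {i}))"
    using e by (intro sum_mono) auto
  also have "\<dots> = \<epsilon>" using sum_measure_cells[OF l I] by (simp add: sum_distrib_left[symmetric])
  finally show ?thesis .
qed

section \<open>Iterated push-forwards\<close>

lemma distr_funpow_prob:
  fixes T :: "'x::topological_space \<Rightarrow> 'x"
  assumes "\<nu> \<in> borel_prob_measures" and "T \<in> borel \<rightarrow>\<^sub>M borel"
  shows "distr \<nu> borel (T ^^ n) \<in> borel_prob_measures"
proof -
  have s: "sets \<nu> = sets borel" and p: "prob_space \<nu>" using assms(1) borel_prob_measures_iff by auto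
  have "T ^^ n \<in> \<nu> \<rightarrow>\<^sub>M borel"
    unfolding measurable_cong_sets[OF s refl] by (intro measurable_compose_n assms(2))
  from prob_space.prob_space_distr[OF p this] show ?thesis by (simp add: borel_prob_measures_iff)
qed

lemma distr_funpow_add:
  fixes T :: "'x::topological_space \<Rightarrow> 'x"
  assumes "sets \<nu> = sets borel" and T: "T \<in> borel \<rightarrow>\<^sub>M borel"
  shows "distr \<nu> borel (T ^^ (m + k)) = distr (distr \<nu> borel (T ^^ k)) borel (T ^^ m)"
proof -
  have "T ^^ k \<in> \<nu> \<rightarrow>\<^sub>M borel"
    unfolding measurable_cong_sets[OF assms(1) refl] by (rule measurable_compose_n[OF T])
  from distr_distr[OF measurable_compose_n[OF T, of m] this] show ?thesis
    by (simp add: funpow_add)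
qed

lemma distr_funpow_invariant:
  fixes T :: "'x::topological_space \<Rightarrow> 'x"
  assumes s: "sets \<mu> = sets borel" and T: "T \<in> borel \<rightarrow>\<^sub>M borel" and inv: "distr \<mu> borel T = \<mu>"
  shows "distr \<mu> borel (T ^^ n) = \<mu>"
proof (induction n)
  case 0
  show ?case using s by (simp add: id_def distr_id2)
next
  case (Suc n)
  then show ?case using distr_funpow_add[OF s T, of 1 n] inv by (simp add: comp_def)
qed


section \<open>Exponential convergence\<close>

text \<open>With \<open>m\<close> and \<open>k\<close> both about \<open>n / 2\<close>, the rate is \<open>sqrt q\<close>; the division by \<open>sqrt q\<close> in the
  constant absorbs the rounding for odd \<open>n\<close>.\<close>

lemma half_split_exponential_rate:
  fixes q c\<^sub>1 c\<^sub>2 :: real and w :: "nat \<Rightarrow> real"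
  assumes q: "0 < q" "q < 1" and c: "0 \<le> c\<^sub>1" "0 \<le> c\<^sub>2"
    and w: "\<And>m k. w (m + k) \<le> c\<^sub>1 * q ^ m + c\<^sub>2 * q ^ k"
  shows "\<exists>C>0. \<exists>\<eta>. 0 < \<eta> \<and> \<eta> < 1 \<and> (\<forall>n. w n \<le> C * \<eta> ^ n)"
proof -
  define \<eta> where "\<eta> = sqrt q"
  have \<eta>: "0 < \<eta>" "\<eta> < 1" using q by (auto simp: \<eta>_def)
  have q\<eta>: "q ^ j = \<eta> ^ (2 * j)" for j using q(1) by (simp add: \<eta>_def power_mult)
  have small: "q ^ j \<le> \<eta> ^ n / \<eta>" if "n \<le> 2 * j + 1" for j n
  proof -
    have "\<eta> ^ (2 * j + 1) \<le> \<eta> ^ n" using that \<eta> by (intro power_decreasing) auto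
    then show ?thesis using \<eta> by (simp add: q\<eta> field_simps)
  qed
  have "w n \<le> ((c\<^sub>1 + c\<^sub>2 + 1) / \<eta>) * \<eta> ^ n" for n
  proof -
    have "w n \<le> c\<^sub>1 * q ^ (n - n div 2) + c\<^sub>2 * q ^ (n div 2)"
      using w[of "n - n div 2" "n div 2"] by simp
    also have "\<dots> \<le> c\<^sub>1 * (\<eta> ^ n / \<eta>) + c\<^sub>2 * (\<eta> ^ n / \<eta>)"
      using c by (intro add_mono mult_left_mono small) auto
    also have "\<dots> \<le> ((c\<^sub>1 + c\<^sub>2 + 1) / \<eta>) * \<eta> ^ n" using \<eta> by (simp add: field_simps)
    finally show ?thesis .
  qed
  moreover have "0 < (c\<^sub>1 + c\<^sub>2 + 1) / \<eta>" using c \<eta> by simp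
  ultimately show ?thesis using \<eta> by blast
qed

text \<open>Mass over a common cell is coupled and contracted to scale \<open>c\<close>, and the remaining proportion
  is at most \<open>\<epsilon>\<close>. The mesh of the partition is chosen after \<open>F\<close> by a compactness argument that
  gives no explicit value, which is harmless because the bound does not involve the mesh.\<close>

lemma wasserstein_lift_le:
  fixes p :: "'x::metric_space \<Rightarrow> 'y::metric_space" and F :: "'x \<Rightarrow> 'x" and g :: "'y \<Rightarrow> real"
  assumes X: "compact (UNIV :: 'x set)" and Y: "compact (UNIV :: 'y set)"
    and p: "continuous_on UNIV p" and F: "continuous_on UNIV F"
    and fib: "\<And>x x'. p x = p x' \<Longrightarrow> dist (F x) (F x') < c" and c: "0 \<le> c"
    and \<alpha>: "\<alpha> \<in> borel_prob_measures" and \<beta>: "\<beta> \<in> borel_prob_measures"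
    and l: "l \<in> borel_prob_measures" and g: "integrable l g" "\<And>y. \<bar>g y\<bar> \<le> \<epsilon>"
    and diff: "\<And>A. A \<in> sets borel \<Longrightarrow> measure \<alpha> (p -` A) - measure \<beta> (p -` A) = (LINT y:A|l. g y)"
    and D: "\<And>x x' :: 'x. dist x x' \<le> D"
  shows "wasserstein (distr \<alpha> borel F) (distr \<beta> borel F) \<le> c + D * \<epsilon>"
proof -
  have pm: "p \<in> borel \<rightarrow>\<^sub>M borel" using p by (rule borel_measurable_continuous_onI)
  obtain e where e: "0 < e" "\<And>x x'. dist (p x) (p x') < e \<Longrightarrow> dist (F x) (F x') < c"
    using contraction_near_fibers[OF X p F fib] by metis
  obtain I :: "'y \<Rightarrow> nat" and r where I: "\<And>y. I y < r" "\<And>i. I -` {i} \<in> sets borel"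
    and Ie: "\<And>y y'. I y = I y' \<Longrightarrow> dist y y' < e"
    using compact_borel_cells[OF Y e(1)] by metis
  have J: "(\<lambda>x. I (p x)) -` {i} = p -` (I -` {i})" for i by auto
  have Jm: "(\<lambda>x. I (p x)) -` {i} \<in> sets borel" for i
    unfolding J using measurable_sets[OF pm I(2)[of i]] by simp
  have "wasserstein (distr \<alpha> borel F) (distr \<beta> borel F)
      \<le> c + D * (\<Sum>i<r. max 0 (measure \<alpha> ((\<lambda>x. I (p x)) -` {i}) - measure \<beta> ((\<lambda>x. I (p x)) -` {i})))"
  proof (rule wasserstein_distr_le_cells[OF X \<alpha> \<beta> I(1) Jm F _ c D])
    show "dist (F x) (F x') \<le> c" if "I (p x) = I (p x')" for x x'
      using e(2)[OF Ie[OF that]] by simp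
  qed
  also have "\<dots> = c + D * (\<Sum>i<r. max 0 (LINT y:I -` {i}|l. g y))"
    unfolding J diff[OF I(2)] ..
  also have "\<dots> \<le> c + D * \<epsilon>"
    using sum_pos_part_cells_le[OF l I g] D[of undefined undefined]
    by (intro add_left_mono mult_left_mono) auto
  finally show ?thesis .
qed

theorem theorem2:
  fixes T :: "'x::metric_space \<Rightarrow> 'x"
    and S :: "'y::metric_space \<Rightarrow> 'y"
    and p :: "'x \<Rightarrow> 'y"
    and l :: "'y measure"
    and B :: "('y \<Rightarrow> real) set"
    and N :: "('y \<Rightarrow> real) \<Rightarrow> real"
    and h :: "'y \<Rightarrow> real"
    and \<mu> \<nu> :: "'x measure"
  assumes "compact (UNIV :: 'x set)" and "compact (UNIV :: 'y set)"
    and "T \<in> borel \<rightarrow>\<^sub>M borel" and "S \<in> borel \<rightarrow>\<^sub>M borel"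
    and "continuous_on UNIV p" and "surj p" and "p \<circ> T = S \<circ> p"
    and "exponentially_shrinking_fibers T p"
    and "conformal_measure S l"
    and "banach_function_space B N" and "has_spectral_gap S l B N h"
    and "\<exists>c. c-lipschitz_on UNIV T"
    and "holder_continuous_fibration p"
    and "\<mu> \<in> borel_prob_measures" and "distr \<mu> borel T = \<mu>"
    and "distr \<mu> borel p = density l (\<lambda>y. ennreal (h y))"
    and "\<nu> \<in> borel_prob_measures"
    and "\<exists>f\<in>B. (AE y in l. 0 \<le> f y) \<and> distr \<nu> borel p = density l (\<lambda>y. ennreal (f y))"
  shows "\<exists>C>0. \<exists>\<eta>. 0 < \<eta> \<and> \<eta> < 1 \<and>
           (\<forall>n. wasserstein (distr \<nu> borel (T ^^ n)) \<mu> \<le> C * \<eta> ^ n)"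
proof -
  note X = assms(1) and Tm = assms(3) and Sm = assms(4) and pc = assms(5) and semi = assms(7)
    and \<mu> = assms(14) and inv = assms(15) and \<mu>h = assms(16) and \<nu> = assms(17)
  obtain f where fB: "f \<in> B" and f0: "AE y in l. 0 \<le> f y"
    and \<nu>f: "distr \<nu> borel p = density l (\<lambda>y. ennreal (f y))"
    using assms(18) by blast
  obtain C\<^sub>0 \<theta> where C\<^sub>0: "C\<^sub>0 > 0" and \<theta>: "0 < \<theta>" "\<theta> < 1"
    and shrink: "\<And>n x x'. p x = p x' \<Longrightarrow> dist ((T ^^ n) x) ((T ^^ n) x') \<le> C\<^sub>0 * \<theta> ^ n"
    using assms(8) unfolding exponentially_shrinking_fibers_def by blast
  have l: "l \<in> borel_prob_measures" using assms(9) unfolding conformal_measure_def by blast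
  then have sl: "sets l = sets borel" and pl: "prob_space l" using borel_prob_measures_iff by auto
  have s\<mu>: "sets \<mu> = sets borel" and s\<nu>: "sets \<nu> = sets borel"
    and p\<nu>: "prob_space \<nu>"
    using \<mu> \<nu> borel_prob_measures_iff by auto
  have sp: "space \<mu> = UNIV" "space \<nu> = UNIV" using s\<mu> s\<nu> by (auto dest: sets_eq_imp_space_eq)
  obtain L where L: "transfer_operator_on S l B N L" and hB: "h \<in> B" and h0: "\<And>y. 0 < h y"
    and Lh: "L h = h" and h1: "(LINT y|l. h y) = 1"
    and "\<exists>C\<ge>1. \<exists>\<delta>. 0 < \<delta> \<and> \<delta> < 1 \<and> (\<forall>f\<in>B. (LINT y|l. f y) = 0 \<longrightarrow>
              (\<forall>n. N ((L ^^ n) f) \<le> C * (1 - \<delta>) ^ n * N f))"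
    using assms(11) unfolding has_spectral_gap_def by blast
  then obtain C\<^sub>1 \<delta> where C\<^sub>1: "C\<^sub>1 \<ge> 1" and \<delta>: "0 < \<delta>" "\<delta> < 1"
    and gap: "\<And>g n. g \<in> B \<Longrightarrow> (LINT y|l. g y) = 0 \<Longrightarrow> N ((L ^^ n) g) \<le> C\<^sub>1 * (1 - \<delta>) ^ n * N g"
    by blast
  have Badd: "\<And>g k. g \<in> B \<Longrightarrow> k \<in> B \<Longrightarrow> (\<lambda>y. g y + k y) \<in> B"
    and Bscale: "\<And>c g. g \<in> B \<Longrightarrow> (\<lambda>y. c * g y) \<in> B"
    and N0: "\<And>g. g \<in> B \<Longrightarrow> 0 \<le> N g"
    and Nsup: "\<And>g y. g \<in> B \<Longrightarrow> \<bar>g y\<bar> \<le> N g"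
    using assms(10) unfolding banach_function_space_def by blast+
  have LB: "\<And>g. g \<in> B \<Longrightarrow> L g \<in> B \<and> transfer_version S l g (L g)"
    and Ladd: "\<And>g k. g \<in> B \<Longrightarrow> k \<in> B \<Longrightarrow> L (\<lambda>y. g y + k y) = (\<lambda>y. L g y + L k y)"
    and Lscale: "\<And>c g. g \<in> B \<Longrightarrow> L (\<lambda>y. c * g y) = (\<lambda>y. c * L g y)"
    using L unfolding transfer_operator_on_def by blast+
  have Bint: "integrable l g" if "g \<in> B" for g using LB[OF that] by (simp add: transfer_version_def)
  have LnB: "(L ^^ k) g \<in> B" if "g \<in> B" for g k using that LB by (induction k) auto
  have pm: "p \<in> borel \<rightarrow>\<^sub>M borel" using pc by (rule borel_measurable_continuous_onI)
  then have p\<mu>m: "p \<in> \<mu> \<rightarrow>\<^sub>M borel" and p\<nu>m: "p \<in> \<nu> \<rightarrow>\<^sub>M borel"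
    unfolding measurable_cong_sets[OF s\<mu> refl] measurable_cong_sets[OF s\<nu> refl] by auto
  \<comment> \<open>The difference \<open>f - h\<close>, written with the operations under which \<open>B\<close> is closed.\<close>
  define d where "d = (\<lambda>y. f y + (- 1) * h y)"
  have dB: "d \<in> B" unfolding d_def using Badd Bscale fB hB by blast
  have "(LINT y|l. f y) = 1"
    using measure_lift_eq[OF p\<nu>m _ sl Bint[OF fB] f0 \<nu>f, of UNIV] prob_space.prob_space[OF p\<nu>] sp
    by (simp add: set_lebesgue_integral_def)
  then have d0: "(LINT y|l. d y) = 0"
    unfolding d_def using Bint fB hB h1 by simp
  have Ld: "(L ^^ k) d = (\<lambda>y. (L ^^ k) f y + (- 1) * h y)" for k
  proof (induction k)
    case (Suc k)
    have "L (\<lambda>y. (L ^^ k) f y + (- 1) * h y) = (\<lambda>y. L ((L ^^ k) f) y + (- 1) * L h y)"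
      unfolding Ladd[OF LnB[OF fB] Bscale[OF hB]] Lscale[OF hB] ..
    then show ?case by (simp only: funpow.simps comp_apply Suc.IH Lh)
  qed (simp add: d_def)
  obtain D where D: "\<And>x x' :: 'x. dist x x' \<le> D"
    using compact_imp_bounded[OF X] bounded_two_points[of "UNIV :: 'x set"] by auto
  then have D0: "0 \<le> D" by (metis dist_self)
  obtain c where "c-lipschitz_on UNIV T" using assms(12) by blast
  then have Tc: "continuous_on UNIV T" by (rule lipschitz_on_continuous_on)
  have Tmc: "continuous_on UNIV (T ^^ m)" for m
  proof (induction m)
    case (Suc m)
    then show ?case using continuous_on_compose2[OF Tc Suc.IH] by (simp add: comp_def)
  qed (simp add: id_def)
  have comm: "p ((T ^^ k) x) = (S ^^ k) (p x)" for k x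
    using semi by (induction k) (auto simp: fun_eq_iff)
  define q where "q = max \<theta> (1 - \<delta>)"
  have q: "0 < q" "q < 1" "\<theta> \<le> q" "1 - \<delta> \<le> q" using \<theta> \<delta> by (auto simp: q_def)
  have est: "wasserstein (distr \<nu> borel (T ^^ (m + k))) \<mu>
      \<le> 2 * C\<^sub>0 * q ^ m + D * (C\<^sub>1 * N d) * q ^ k" for m k
  proof -
    define \<alpha> where "\<alpha> = distr \<nu> borel (T ^^ k)"
    have \<alpha>: "\<alpha> \<in> borel_prob_measures" unfolding \<alpha>_def by (rule distr_funpow_prob[OF \<nu> Tm])
    have Tk: "T ^^ k \<in> \<nu> \<rightarrow>\<^sub>M borel" 
      unfolding measurable_cong_sets[OF s\<nu> refl] by (rule measurable_compose_n[OF Tm])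
    have diff: "measure \<alpha> (p -` A) - measure \<mu> (p -` A) = (LINT y:A|l. (L ^^ k) d y)"
      if A: "A \<in> sets borel" for A
    proof -
      have pA: "p -` A \<in> sets borel" using measurable_sets[OF pm A] by simp
      have SA: "(S ^^ k) -` A \<in> sets borel"
        using measurable_sets[OF measurable_compose_n[OF Sm] A] by simp
      have "measure \<alpha> (p -` A) = measure \<nu> ((T ^^ k) -` (p -` A))"
        unfolding \<alpha>_def using measure_distr[OF Tk pA] sp by simp
      also have "(T ^^ k) -` (p -` A) = p -` ((S ^^ k) -` A)" using comm by auto
      also have "measure \<nu> \<dots> = (LINT y:(S ^^ k) -` A|l. f y)"
        using measure_lift_eq[OF p\<nu>m SA sl Bint[OF fB] f0 \<nu>f] sp by simp
      also have "\<dots> = (LINT y:A|l. (L ^^ k) f y)"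
        by (rule transfer_version_funpow[OF Sm LB fB A])
      finally have 1: "measure \<alpha> (p -` A) = (LINT y:A|l. (L ^^ k) f y)" .
      have 2: "measure \<mu> (p -` A) = (LINT y:A|l. h y)"
        using measure_lift_eq[OF p\<mu>m A sl Bint[OF hB] _ \<mu>h] h0 sp by (simp add: less_imp_le)
      have "set_integrable l A ((L ^^ k) f)" "set_integrable l A h"
        unfolding set_integrable_def using A sl Bint[OF LnB[OF fB]] Bint[OF hB]
        by (auto intro!: integrable_mult_indicator simp del: real_scaleR_def)
      then show ?thesis unfolding 1 2 Ld by (simp flip: set_integral_diff(2))
    qed
    have bound: "\<bar>(L ^^ k) d y\<bar> \<le> C\<^sub>1 * (1 - \<delta>) ^ k * N d" for y
      using Nsup[OF LnB[OF dB]] gap[OF dB d0] order_trans by blast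
    have "wasserstein (distr \<alpha> borel (T ^^ m)) (distr \<mu> borel (T ^^ m))
        \<le> 2 * C\<^sub>0 * \<theta> ^ m + D * (C\<^sub>1 * (1 - \<delta>) ^ k * N d)"
    \<comment> \<open>The factor \<open>2\<close> makes the contraction along fibers strict, so that it extends to
      neighbouring fibers.\<close>
    proof (rule wasserstein_lift_le[OF X assms(2) pc Tmc _ _ \<alpha> \<mu> l Bint[OF LnB[OF dB]] bound diff D])
      fix x x' assume "p x = p x'"
      from shrink[OF this, of m] have "dist ((T ^^ m) x) ((T ^^ m) x') \<le> C\<^sub>0 * \<theta> ^ m" .
      also have "\<dots> < 2 * C\<^sub>0 * \<theta> ^ m" using C\<^sub>0 \<theta> by simp
      finally show "dist ((T ^^ m) x) ((T ^^ m) x') < 2 * C\<^sub>0 * \<theta> ^ m" .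
    qed (use C\<^sub>0 \<theta> in auto)
    also have "\<dots> = 2 * C\<^sub>0 * \<theta> ^ m + D * (C\<^sub>1 * N d) * (1 - \<delta>) ^ k" by (simp add: mult_ac)
    also have "\<dots> \<le> 2 * C\<^sub>0 * q ^ m + D * (C\<^sub>1 * N d) * q ^ k"
      using C\<^sub>0 C\<^sub>1 D0 N0[OF dB] q \<theta> \<delta> by (intro add_mono mult_left_mono power_mono) auto
    finally show ?thesis
      unfolding \<alpha>_def distr_funpow_add[OF s\<nu> Tm] distr_funpow_invariant[OF s\<mu> Tm inv] .
  qed
  show ?thesis
    using C\<^sub>0 C\<^sub>1 D0 N0[OF dB] by (intro half_split_exponential_rate[OF q(1,2) _ _ est]) auto
qed

end
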